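(* For any real $t$, we have $\kappa(t)=\frac{2k+1}{2}$ for some $k\in\mathbf{Z}$ if and only if $Z'(t)=0$ and $Z(t)\ne0$.
   Context: $\zeta$ is Riemann's zeta function; $\vartheta\colon\mathbf{R}\to\mathbf{R}$ is the Riemann–Siegel theta function, i.e. the real analytic function with $\vartheta(0)=0$ and $\Gamma(\frac14+\frac{it}{2})=|\Gamma(\frac14+\frac{it}{2})|\,e^{i(\vartheta(t)+\frac t2\log\pi)}$. $Z\colon\mathbf{R}\to\mathbf{R}$ is the real analytic function $Z(t)=e^{i\vartheta(t)}\zeta(\frac12+it)$. The function $\kappa\colon\mathbf{R}\to\mathbf{R}$ is the unique real analytic function with $\kappa(0)=-\frac12$ and $e^{2\pi i\kappa(t)}=1+2\vartheta'(t)\frac{\zeta(1/2+it)}{\zeta'(1/2+it)}$ for all real $t$ (the quotient is extended analytically, with value $0$, at points where $\zeta'(\frac12+it)=0$; such points are zeros of $\zeta(\frac12+it)$). *)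

theory Defs
  imports "HOL-Complex_Analysis.Complex_Analysis"
begin

definition real_analytic :: "(real \<Rightarrow> real) \<Rightarrow> bool" where
  "real_analytic f \<longleftrightarrow>
     (\<forall>x. \<exists>a r. r > 0 \<and> (\<forall>y. \<bar>y - x\<bar> < r \<longrightarrow> (\<lambda>n. a n * (y - x) ^ n) sums f y))"

(* The holomorphic function on the plane minus {1} that continues the Dirichlet series.
   It is determined everywhere except at 1; the value at the pole is pinned to 0
   only so that the description is unique. *)
definition zeta :: "complex \<Rightarrow> complex" where
  "zeta = (THE f. f holomorphic_on (- {1}) \<and> f 1 = 0 \<and>
     (\<forall>s. Re s > 1 \<longrightarrow> f s = (\<Sum>n. 1 / of_nat (Suc n) powr s)))"

definition riemann_siegel_theta :: "real \<Rightarrow> real" where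
  "riemann_siegel_theta = (THE \<theta>. real_analytic \<theta> \<and> \<theta> 0 = 0 \<and>
     (\<forall>t. Gamma (1/4 + \<i> * of_real t / 2) =
          of_real (norm (Gamma (1/4 + \<i> * of_real t / 2))) *
          exp (\<i> * of_real (\<theta> t + t / 2 * ln pi))))"

(* The values are real, by the functional equation of zeta; the codomain is complex so that
   the defining formula can be used as it stands. *)
definition hardy_Z :: "real \<Rightarrow> complex" where
  "hardy_Z t = exp (\<i> * of_real (riemann_siegel_theta t)) * zeta (1/2 + \<i> * of_real t)"

(* zeta / zeta' on the critical line.  The zeros of zeta' there are zeros of zeta, of
   multiplicity at least 2, so 0 is the value of the analytic extension at these points. *)
definition zeta_quotient :: "real \<Rightarrow> complex" where
  "zeta_quotient t =
     (if deriv zeta (1/2 + \<i> * of_real t) = 0 then 0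
      else zeta (1/2 + \<i> * of_real t) / deriv zeta (1/2 + \<i> * of_real t))"

(* The three conditions determine kappa uniquely. *)
definition is_kappa :: "(real \<Rightarrow> real) \<Rightarrow> bool" where
  "is_kappa \<kappa> \<longleftrightarrow> real_analytic \<kappa> \<and> \<kappa> 0 = - 1/2 \<and>
     (\<forall>t. exp (2 * of_real pi * \<i> * of_real (\<kappa> t)) =
          1 + 2 * of_real (deriv riemann_siegel_theta t) * zeta_quotient t)"

end

theory Submission
  imports Defs
begin

text \<open>
  Since \<open>Z' = i exp (i \<theta>) (\<zeta>' + \<theta>' \<zeta>)\<close> and \<open>\<kappa>\<close> is half an odd integer iff \<open>\<theta>' \<zeta> / \<zeta>' = - 1\<close>, only
  points with \<open>\<zeta>' = 0\<close> need an argument: one must exclude \<open>\<theta>' = 0\<close>, \<open>\<zeta> \<noteq> 0\<close> there. This needs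
  no functional equation and no numerical computation. Continuity of \<open>\<kappa>\<close> forces
  \<open>\<theta>' \<zeta> / \<zeta>' \<rightarrow> 0\<close> at such a point, hence also \<open>\<theta>' \<zeta> / (u - t) \<rightarrow> 0\<close>, so \<open>\<theta>'' \<zeta> = 0\<close>; but \<open>\<theta>'\<close> has
  only simple zeros, because \<open>\<theta>'(0) < 0\<close> and the series of the trigamma function shows
  \<open>\<theta>''(t) \<noteq> 0\<close> for \<open>t \<noteq> 0\<close>.

  The analytic continuation of \<open>\<zeta>\<close> comes from summing the Taylor expansion of
  \<open>(n + 1) powr (1 - s)\<close> around \<open>n\<close> over all \<open>n\<close>: the left-hand sides telescope, and
  \<open>(s - 1) \<zeta>(s)\<close> is expressed by its values at \<open>s + 1, \<dots>, s + k\<close> and a remainder series that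
  converges for \<open>Re s > - k\<close>.
\<close>

subsection \<open>Analytic continuation of the zeta function\<close>

text \<open>The falling factorial a(a-1)...(a-k+1), the coefficient of the k-th derivative of
  \<open>x powr a\<close>.\<close>

definition ffact :: "complex \<Rightarrow> nat \<Rightarrow> complex" where
  "ffact a k = (\<Prod>j<k. a - of_nat j)"

lemma ffact_0 [simp]: "ffact a 0 = 1" and ffact_Suc [simp]: "ffact a (Suc k) = ffact a k * (a - of_nat k)"
  by (simp_all add: ffact_def)

lemma holomorphic_on_ffact [holomorphic_intros]:
  "f holomorphic_on A \<Longrightarrow> (\<lambda>s. ffact (f s) k) holomorphic_on A"
  unfolding ffact_def by (intro holomorphic_intros)

text \<open>The error at n + 1 of the Taylor polynomial of degree k of \<open>x powr a\<close>
  around n.\<close>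

definition powr_remainder :: "nat \<Rightarrow> nat \<Rightarrow> complex \<Rightarrow> complex" where
  "powr_remainder k n a = of_nat (Suc n) powr a -
     (\<Sum>i\<le>k. ffact a i * of_nat n powr (a - of_nat i) / fact i)"

text \<open>Taylor's theorem on the segment from n to n + 1: the bound on \<open>Re a\<close> makes
  the modulus of the (k+1)-st derivative nonincreasing there, so it is largest at n.\<close>

lemma norm_powr_remainder_le:
  assumes "n > 0" "Re a \<le> real (Suc k)"
  shows "norm (powr_remainder k n a) \<le> norm (ffact a (Suc k)) * real n powr (Re a - real (Suc k))"
proof -
  let ?S = "closed_segment (of_nat n :: complex) (of_nat (Suc n))"
  have S: "x \<in> \<real> \<and> Re x \<ge> real n" if "x \<in> ?S" for x
  proof -
    from that obtain u where u: "0 \<le> u" "x = (1 - u) *\<^sub>R of_nat n + u *\<^sub>R of_nat (Suc n)"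
      by (auto simp: in_segment)
    hence "x = of_real (real n + u)"
      by (simp add: scaleR_conv_of_real algebra_simps)
    thus ?thesis using u by auto
  qed
  define f where "f i x = ffact a i * x powr (a - of_nat i)" for i x
  define B where "B = norm (ffact a (Suc k)) * real n powr (Re a - real (Suc k))"
  have "norm (f 0 (of_nat (Suc n)) - (\<Sum>i\<le>k. f i (of_nat n) * (of_nat (Suc n) - of_nat n) ^ i / fact i))
        \<le> B * norm (of_nat (Suc n) - of_nat n :: complex) ^ Suc k / fact k"
  proof (rule complex_Taylor[of ?S])
    fix i x assume x: "x \<in> ?S" and "i \<le> k"
    have "x \<notin> \<real>\<^sub>\<le>\<^sub>0"
      using S[OF x] \<open>n > 0\<close> by (auto simp: complex_nonpos_Reals_iff)
    hence "((\<lambda>x. ffact a i * x powr (a - of_nat i)) has_field_derivative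
        ffact a i * ((a - of_nat i) * x powr (a - of_nat i - 1))) (at x within ?S)"
      by (intro DERIV_cmult has_field_derivative_at_within[OF has_field_derivative_powr])
    thus "(f i has_field_derivative f (Suc i) x) (at x within ?S)"
      unfolding f_def by (simp add: algebra_simps)
  next
    fix x assume x: "x \<in> ?S"
    have "norm (x powr (a - of_nat (Suc k))) = Re x powr (Re a - real (Suc k))"
      using S[OF x] by (subst norm_powr_real_powr) auto
    also have "\<dots> \<le> real n powr (Re a - real (Suc k))"
      using S[OF x] assms by (intro powr_mono2') auto
    finally show "norm (f (Suc k) x) \<le> B"
      unfolding f_def B_def norm_mult by (intro mult_left_mono) auto
  qed auto
  \<comment> \<open>The segment has length 1, and dividing by \<open>fact k\<close> only decreases
    the bound.\<close>
  also have "B * norm (of_nat (Suc n) - of_nat n :: complex) ^ Suc k / fact k \<le> B / 1"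
    using fact_ge_1[of k] by (intro frac_le) (auto simp: B_def simp del: ffact_Suc)
  finally show ?thesis
    by (simp add: f_def B_def powr_remainder_def)
qed

text \<open>The Weierstrass M-test on small discs: \<open>c\<close> is bounded on a closed disc, and
  the powers are dominated there by a convergent p-series.\<close>

lemma series_holomorphic_powr_bound:
  fixes f :: "nat \<Rightarrow> complex \<Rightarrow> complex" and c :: "complex \<Rightarrow> complex"
  assumes hol: "\<And>n. f n holomorphic_on {s. Re s > 1 - real k}"
    and c: "c holomorphic_on {s. Re s > 1 - real k}"
    and bound: "\<And>n s. Re s > 1 - real k \<Longrightarrow>
        norm (f n s) \<le> norm (c s) * real (Suc n) powr (- Re s - real k)"
  shows "(\<lambda>s. \<Sum>n. f n s) holomorphic_on {s. Re s > 1 - real k}"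
    and "Re s > 1 - real k \<Longrightarrow> summable (\<lambda>n. f n s)"
proof -
  let ?H = "{s. Re s > 1 - real k}"
  have op: "open ?H" by (rule open_halfspace_Re_gt)
  have "\<exists>g g'. \<forall>x\<in>?H. (\<lambda>n. f n x) sums g x \<and> (\<lambda>n. deriv (f n) x) sums g' x \<and>
          (g has_field_derivative g' x) (at x)"
  proof (rule series_and_derivative_comparison_local[OF op])
    fix n x assume "x \<in> ?H"
    thus "(f n has_field_derivative deriv (f n) x) (at x)"
      using hol op by (intro holomorphic_derivI)
  next
    fix x assume x: "x \<in> ?H"
    then obtain d where d: "d > 0" "cball x d \<subseteq> ?H"
      using op open_contains_cball by blast
    have "continuous_on (cball x d) c"
      using c d by (meson holomorphic_on_imp_continuous_on holomorphic_on_subset)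
    hence "bounded (c ` cball x d)"
      by (intro compact_imp_bounded compact_continuous_image) auto
    then obtain C where C: "\<And>y. y \<in> cball x d \<Longrightarrow> norm (c y) \<le> C"
      unfolding bounded_iff by blast
    \<comment> \<open>The least real part on the closed disc. Its leftmost point lies in the
      half-plane, so the exponent \<open>- \<sigma> - real k\<close> is below -1.\<close>
    define \<sigma> where "\<sigma> = Re x - d"
    have "x - of_real d \<in> cball x d" using d by (simp add: dist_norm)
    hence "x - of_real d \<in> ?H" using d(2) by blast
    hence \<sigma>: "\<sigma> > 1 - real k" by (simp add: \<sigma>_def)
    have C0: "C \<ge> 0" using order_trans[OF norm_ge_zero C[of x]] d by simp
    have "summable (\<lambda>n. C * real (Suc n) powr (- \<sigma> - real k))"
      using \<sigma> summable_real_powr_iff[of "- \<sigma> - real k"]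
      by (intro summable_mult) (subst summable_Suc_iff, auto)
    moreover have "norm (f n y) \<le> C * real (Suc n) powr (- \<sigma> - real k)" if y: "y \<in> ball x d \<inter> ?H" for n y
    proof -
      have "norm (y - x) \<le> d" using y by (simp add: dist_norm norm_minus_commute)
      hence "\<sigma> \<le> Re y" using abs_Re_le_cmod[of "y - x"] by (simp add: \<sigma>_def)
      have "norm (f n y) \<le> norm (c y) * real (Suc n) powr (- Re y - real k)"
        using bound y by auto
      also have "\<dots> \<le> C * real (Suc n) powr (- \<sigma> - real k)"
        using C[of y] y \<open>\<sigma> \<le> Re y\<close> C0 by (intro mult_mono powr_mono) auto
      finally show ?thesis .
    qed
    ultimately show "\<exists>d h. 0 < d \<and> summable h \<and>
        (\<forall>\<^sub>F n in sequentially. \<forall>y\<in>ball x d \<inter> ?H. norm (f n y) \<le> h n)"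
      using d by (intro exI[of _ d] exI[of _ "\<lambda>n. C * real (Suc n) powr (- \<sigma> - real k)"]) auto
  qed
  then obtain g g' where g: "\<And>x. x \<in> ?H \<Longrightarrow> (\<lambda>n. f n x) sums g x"
      "\<And>x. x \<in> ?H \<Longrightarrow> (g has_field_derivative g' x) (at x)" by blast
  show "summable (\<lambda>n. f n s)" if "Re s > 1 - real k"
    using g(1)[of s] that by (auto simp: sums_iff)
  have "g holomorphic_on ?H"
    using g(2) op holomorphic_on_open by blast
  thus "(\<lambda>s. \<Sum>n. f n s) holomorphic_on ?H"
    by (rule holomorphic_transform) (use g(1) in \<open>auto simp: sums_iff\<close>)
qed

section \<open>The Dirichlet series and its recurrence\<close>

definition dirichlet_zeta :: "complex \<Rightarrow> complex" where
  "dirichlet_zeta s = (\<Sum>n. 1 / of_nat (Suc n) powr s)"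

lemma norm_of_nat_Suc_powr: "norm (of_nat (Suc n) powr s :: complex) = real (Suc n) powr Re s"
  by (subst norm_powr_real_powr) (auto simp del: of_nat_Suc)

lemma
  shows dirichlet_zeta_holomorphic: "dirichlet_zeta holomorphic_on {s. Re s > 1}"
    and dirichlet_zeta_sums: "Re s > 1 \<Longrightarrow> (\<lambda>n. of_nat (Suc n) powr - s) sums dirichlet_zeta s"
proof -
  note * = series_holomorphic_powr_bound[where k = 0 and c = "\<lambda>_. 1"
      and f = "\<lambda>n s. 1 / of_nat (Suc n) powr s"]
  have 1: "(\<lambda>s. 1 / of_nat (Suc n) powr s) holomorphic_on A" for A :: "complex set" and n
    by (intro holomorphic_intros) (simp del: of_nat_Suc)
  have 2: "norm (1 / of_nat (Suc n) powr s :: complex) \<le> norm (1 :: complex) * real (Suc n) powr (- Re s - real 0)" for n s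
    unfolding norm_divide norm_of_nat_Suc_powr by (simp add: powr_minus field_simps)
  show "dirichlet_zeta holomorphic_on {s. Re s > 1}"
    using *(1)[OF 1 _ 2] unfolding dirichlet_zeta_def by simp
  show "(\<lambda>n. of_nat (Suc n) powr - s) sums dirichlet_zeta s" if "Re s > 1"
    using *(2)[OF 1 _ 2, of s] that unfolding dirichlet_zeta_def
    by (simp add: sums_iff powr_minus field_simps del: of_nat_Suc)
qed

lemma
  shows powr_remainder_series_holomorphic:
      "(\<lambda>s. \<Sum>n. powr_remainder k (Suc n) (1 - s)) holomorphic_on {s. Re s > 1 - real k}"
    and powr_remainder_summable:
      "Re s > 1 - real k \<Longrightarrow> summable (\<lambda>n. powr_remainder k (Suc n) (1 - s))"
proof -
  note * = series_holomorphic_powr_bound[where k = k and c = "\<lambda>s. ffact (1 - s) (Suc k)"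
      and f = "\<lambda>n s. powr_remainder k (Suc n) (1 - s)"]
  have 1: "(\<lambda>s. powr_remainder k (Suc n) (1 - s)) holomorphic_on A" for A :: "complex set" and n
    unfolding powr_remainder_def by (intro holomorphic_intros) auto
  have 2: "(\<lambda>s. ffact (1 - s) (Suc k)) holomorphic_on A" for A :: "complex set"
    by (intro holomorphic_intros)
  have 3: "norm (powr_remainder k (Suc n) (1 - s)) \<le>
      norm (ffact (1 - s) (Suc k)) * real (Suc n) powr (- Re s - real k)" if "Re s > 1 - real k" for n s
    using norm_powr_remainder_le[of "Suc n" "1 - s" k] that by simp
  show "(\<lambda>s. \<Sum>n. powr_remainder k (Suc n) (1 - s)) holomorphic_on {s. Re s > 1 - real k}"
    by (rule *(1)[OF 1 2 3])
  show "Re s > 1 - real k \<Longrightarrow> summable (\<lambda>n. powr_remainder k (Suc n) (1 - s))"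
    by (rule *(2)[OF 1 2 3])
qed

text \<open>Summing the Taylor expansions gives a linear relation between the values at s, s + 1,
  ..., s + k. Each value at w is kept together with the factor w - 1 that cancels the pole, so the
  relation is one for a function that will turn out entire.\<close>

lemma dirichlet_zeta_recurrence:
  assumes s: "Re s > 1"
  shows "(s - 1) * dirichlet_zeta s =
    1 - (\<Sum>j=1..k. ffact (1 - s) j / fact (Suc j) * ((s + of_nat j - 1) * dirichlet_zeta (s + of_nat j)))
      + (\<Sum>n. powr_remainder (Suc k) (Suc n) (1 - s))"
proof -
  define a where "a = 1 - s"
  have "(\<lambda>n. of_nat (Suc n) powr a) \<longlonglongrightarrow> 0"
  proof (rule tendsto_norm_zero_cancel)
    have "filterlim (\<lambda>n. real (Suc n)) at_top sequentially"
      by (rule filterlim_compose[OF filterlim_real_sequentially filterlim_Suc])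
    hence "(\<lambda>n. real (Suc n) powr Re a) \<longlonglongrightarrow> 0"
      using s by (intro tendsto_neg_powr) (auto simp: a_def)
    thus "(\<lambda>n. norm (of_nat (Suc n) powr a :: complex)) \<longlonglongrightarrow> 0"
      unfolding norm_of_nat_Suc_powr .
  qed
  hence tele: "(\<lambda>n. of_nat (Suc (Suc n)) powr a - of_nat (Suc n) powr a) sums (0 - of_nat (Suc 0) powr a :: complex)"
    by (rule telescope_sums)
  have D: "(\<lambda>n. of_nat (Suc n) powr (a - of_nat (Suc j))) sums dirichlet_zeta (s + of_nat j)" for j
    using dirichlet_zeta_sums[of "s + of_nat j"] s by (simp add: a_def algebra_simps)
  have "(\<lambda>n. (of_nat (Suc (Suc n)) powr a - of_nat (Suc n) powr a) -
           (\<Sum>j\<le>k. ffact a (Suc j) / fact (Suc j) * of_nat (Suc n) powr (a - of_nat (Suc j)))) sums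
        (- 1 - (\<Sum>j\<le>k. ffact a (Suc j) / fact (Suc j) * dirichlet_zeta (s + of_nat j)))"
  proof -
    have "(\<lambda>n. \<Sum>j\<le>k. ffact a (Suc j) / fact (Suc j) * of_nat (Suc n) powr (a - of_nat (Suc j))) sums
        (\<Sum>j\<le>k. ffact a (Suc j) / fact (Suc j) * dirichlet_zeta (s + of_nat j))"
      by (intro sums_sum sums_mult D)
    from sums_diff[OF tele this] show ?thesis by simp
  qed
  \<comment> \<open>The Taylor term of index 0 is the power subtracted in the telescoping
    difference; the others are reindexed by one.\<close>
  also have "(\<lambda>n. (of_nat (Suc (Suc n)) powr a - of_nat (Suc n) powr a) -
           (\<Sum>j\<le>k. ffact a (Suc j) / fact (Suc j) * of_nat (Suc n) powr (a - of_nat (Suc j)))) =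
        (\<lambda>n. powr_remainder (Suc k) (Suc n) a)"
    unfolding powr_remainder_def
    by (subst sum.atMost_Suc_shift) (simp add: diff_diff_eq del: of_nat_Suc ffact_Suc fact_Suc)
  finally have 1: "(\<Sum>n. powr_remainder (Suc k) (Suc n) a) =
      - 1 - (\<Sum>j\<le>k. ffact a (Suc j) / fact (Suc j) * dirichlet_zeta (s + of_nat j))"
    by (rule sums_unique[symmetric])
  have "(\<Sum>j\<le>k. ffact a (Suc j) / fact (Suc j) * dirichlet_zeta (s + of_nat j)) =
     a * dirichlet_zeta s + (\<Sum>j=1..k. ffact a (Suc j) / fact (Suc j) * dirichlet_zeta (s + of_nat j))"
    by (simp add: atMost_atLeast0 sum.atLeast_Suc_atMost del: fact_Suc)
  \<comment> \<open>The last factor of \<open>ffact a (Suc j)\<close> is a - j = -(s + j -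
    1).\<close>
  also have "(\<Sum>j=1..k. ffact a (Suc j) / fact (Suc j) * dirichlet_zeta (s + of_nat j)) =
     - (\<Sum>j=1..k. ffact a j / fact (Suc j) * ((s + of_nat j - 1) * dirichlet_zeta (s + of_nat j)))"
    unfolding sum_negf[symmetric]
    by (intro sum.cong) (simp_all add: a_def field_simps del: fact_Suc)
  finally have 2: "(\<Sum>j\<le>k. ffact a (Suc j) / fact (Suc j) * dirichlet_zeta (s + of_nat j)) =
     a * dirichlet_zeta s +
     - (\<Sum>j=1..k. ffact a j / fact (Suc j) * ((s + of_nat j - 1) * dirichlet_zeta (s + of_nat j)))" .
  have "d = 1 - S + R" if "R = - 1 - X" "X = T + - S" "T = - d" for d R S T X :: complex
    using that by simp
  from this[OF 1 2, of "(s - 1) * dirichlet_zeta s"] show ?thesis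
    by (simp add: a_def left_diff_distrib)
qed

section \<open>Continuation to the punctured plane\<close>

text \<open>Each induction step widens the half-plane by one: if Re s > -k, then all s + j with j >=
  1 lie in the previous half-plane, and the remainder series of order k + 1 converges.\<close>

lemma zeta_continuation_halfplane:
  "\<exists>G. G holomorphic_on {s. Re s > 1 - real k} \<and> (\<forall>s. Re s > 1 \<longrightarrow> G s = (s - 1) * dirichlet_zeta s)"
proof (induction k)
  case 0
  show ?case
    by (rule exI[of _ "\<lambda>s. (s - 1) * dirichlet_zeta s"])
       (auto intro!: holomorphic_intros dirichlet_zeta_holomorphic)
next
  case (Suc k)
  then obtain G where G: "G holomorphic_on {s. Re s > 1 - real k}"
    "\<And>s. Re s > 1 \<Longrightarrow> G s = (s - 1) * dirichlet_zeta s" by blast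
  define F where "F s = 1 - (\<Sum>j=1..k. ffact (1 - s) j / fact (Suc j) * G (s + of_nat j))
      + (\<Sum>n. powr_remainder (Suc k) (Suc n) (1 - s))" for s
  have "(G \<circ> (\<lambda>s. s + of_nat j)) holomorphic_on {s. Re s > 1 - real (Suc k)}" if "j \<ge> 1" for j
    by (rule holomorphic_on_compose_gen[OF _ G(1)]) (use that in \<open>auto intro!: holomorphic_intros\<close>)
  hence "F holomorphic_on {s. Re s > 1 - real (Suc k)}"
    unfolding F_def by (intro holomorphic_intros powr_remainder_series_holomorphic) (auto simp: o_def)
  moreover have "F s = (s - 1) * dirichlet_zeta s" if "Re s > 1" for s
    using that by (simp add: dirichlet_zeta_recurrence[OF that, of k] F_def G(2) add_strict_increasing del: fact_Suc)
  ultimately show ?case by blast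
qed

text \<open>By the identity theorem the continuations agree on common half-planes, so they glue
  together.\<close>

lemma zeta_continuation_entire:
  "\<exists>E. E holomorphic_on UNIV \<and> (\<forall>s. Re s > 1 \<longrightarrow> E s = (s - 1) * dirichlet_zeta s)"
proof -
  let ?H = "\<lambda>k. {s. Re s > 1 - real k}"
  obtain G where G: "\<And>k. G k holomorphic_on ?H k"
    "\<And>k s. Re s > 1 \<Longrightarrow> G k s = (s - 1) * dirichlet_zeta s"
    using zeta_continuation_halfplane by metis
  have op: "open (?H k)" and conn: "connected (?H k)" for k
    by (auto intro: open_halfspace_Re_gt convex_connected convex_halfspace_Re_gt)
  have agree: "G l s = G k s" if "k \<le> l" "s \<in> ?H k" for k l s
  proof (rule analytic_continuation_open[of "{s. Re s > 1}" "?H k" "G l" "G k"])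
    show "G l holomorphic_on ?H k"
      by (rule holomorphic_on_subset[OF G(1)]) (use that in auto)
    show "{s. Re s > 1} \<noteq> {}"
      by (auto intro: exI[of _ 2])
  qed (use that G op conn in \<open>auto intro: open_halfspace_Re_gt\<close>)
  \<comment> \<open>The index k chosen here satisfies 1 - k < Re s; by \<open>agree\<close> the
    value does not depend on this choice.\<close>
  define E where "E s = G (nat \<lceil>2 - Re s\<rceil>) s" for s
  have mem: "s \<in> ?H (nat \<lceil>2 - Re s\<rceil>)" for s by simp linarith
  have E: "E s = G k s" if "s \<in> ?H k" for k s
    using agree[of k "nat \<lceil>2 - Re s\<rceil>" s] agree[of "nat \<lceil>2 - Re s\<rceil>" k s] that mem[of s]
    unfolding E_def by (cases "k \<le> nat \<lceil>2 - Re s\<rceil>") auto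
  have "E holomorphic_on (\<Union>k. ?H k)"
    by (intro holomorphic_on_UN_open op holomorphic_transform[OF G(1)]) (use E in auto)
  moreover have "(\<Union>k. ?H k) = UNIV"
    using mem by blast
  moreover have "E s = (s - 1) * dirichlet_zeta s" if "Re s > 1" for s
    using E[of s 0] G(2) that by simp
  ultimately show ?thesis by metis
qed

text \<open>Justifies the definite description: dividing the entire function by s - 1 gives
  existence, the identity theorem on the connected punctured plane gives uniqueness.\<close>

lemma zeta_characterization:
  "zeta holomorphic_on (- {1}) \<and> zeta 1 = 0 \<and>
     (\<forall>s. Re s > 1 \<longrightarrow> zeta s = (\<Sum>n. 1 / of_nat (Suc n) powr s))"
proof -
  obtain E where E: "E holomorphic_on UNIV"
    "\<And>s. Re s > 1 \<Longrightarrow> E s = (s - 1) * dirichlet_zeta s"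
    using zeta_continuation_entire by blast
  define f where "f s = (if s = 1 then 0 else E s / (s - 1))" for s
  have "(\<lambda>s. E s / (s - 1)) holomorphic_on (- {1})"
    by (intro holomorphic_intros holomorphic_on_subset[OF E(1)]) auto
  hence hol: "f holomorphic_on (- {1})"
    by (rule holomorphic_transform) (auto simp: f_def)
  have ser: "f s = (\<Sum>n. 1 / of_nat (Suc n) powr s)" if "Re s > 1" for s
    using that E(2)[of s] by (auto simp: f_def dirichlet_zeta_def)
  show ?thesis
    unfolding zeta_def
  proof (rule theI[of _ f])
    show "f holomorphic_on (- {1}) \<and> f 1 = 0 \<and>
        (\<forall>s. Re s > 1 \<longrightarrow> f s = (\<Sum>n. 1 / of_nat (Suc n) powr s))"
      using hol ser by (auto simp: f_def)
  next
    fix g :: "complex \<Rightarrow> complex"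
    assume g: "g holomorphic_on (- {1}) \<and> g 1 = 0 \<and>
        (\<forall>s. Re s > 1 \<longrightarrow> g s = (\<Sum>n. 1 / of_nat (Suc n) powr s))"
    show "g = f"
    proof
      fix s
      show "g s = f s"
      proof (cases "s = 1")
        case False
        show ?thesis
        proof (rule analytic_continuation_open[of "{s. Re s > 1}" "- {1}" g f])
          show "{s. Re s > 1} \<noteq> {}" by (auto intro: exI[of _ 2])
          show "connected (- {1 :: complex})"
            by (intro connected_punctured_universe) auto
        qed (use g hol ser False in \<open>auto intro: open_halfspace_Re_gt\<close>)
      qed (use g in \<open>auto simp: f_def\<close>)
    qed
  qed
qed

lemma zeta_holomorphic: "zeta holomorphic_on (- {1})"
  using zeta_characterization by blast

lemma zeta_has_field_derivative: "s \<noteq> 1 \<Longrightarrow> (zeta has_field_derivative deriv zeta s) (at s)"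
  by (rule holomorphic_derivI[OF zeta_holomorphic]) auto

section \<open>Zeros of the derivative of zeta are isolated\<close>

text \<open>Serves to show that \<open>zeta\<close> is not constant; the two series are compared
  term by term.\<close>

lemma zeta_2_ne_zeta_3: "zeta 2 \<noteq> zeta 3"
proof -
  have z: "(\<lambda>n. 1 / real (Suc n) ^ m) sums Re (zeta (of_nat m))" if "m \<ge> 2" for m
  proof -
    have "(\<lambda>n. of_nat (Suc n) powr - of_nat m) sums zeta (of_nat m)"
      using dirichlet_zeta_sums[of "of_nat m"] zeta_characterization that
      by (simp add: dirichlet_zeta_def)
    hence "(\<lambda>n. Re (of_nat (Suc n) powr - of_nat m)) sums Re (zeta (of_nat m))"
      by (rule sums_Re)
    also have "(\<lambda>n. Re (of_nat (Suc n) powr - of_nat m)) = (\<lambda>n. 1 / real (Suc n) ^ m)"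
    proof
      fix n
      have "(of_nat (Suc n) powr - of_nat m :: complex) = of_real (1 / real (Suc n) ^ m)"
        by (simp add: powr_minus field_simps del: of_nat_Suc)
      thus "Re (of_nat (Suc n) powr - of_nat m) = 1 / real (Suc n) ^ m" by simp
    qed
    finally show ?thesis .
  qed
  have d: "(\<lambda>n. 1 / real (Suc n) ^ 2 - 1 / real (Suc n) ^ 3) sums (Re (zeta 2) - Re (zeta 3))"
    using sums_diff[OF z[of 2] z[of 3]] by simp
  have "0 < (\<Sum>n. 1 / real (Suc n) ^ 2 - 1 / real (Suc n) ^ 3)"
  \<comment> \<open>Index 1 is the term 1/4 - 1/8, the first positive one.\<close>
  proof (rule suminf_pos2[of _ 1])
    show "0 \<le> 1 / real (Suc n) ^ 2 - 1 / real (Suc n) ^ 3" for n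
      by (simp add: frac_le power_increasing del: of_nat_Suc)
  qed (use d in \<open>auto simp: sums_iff\<close>)
  thus ?thesis using d by (auto simp: sums_iff)
qed

text \<open>If the derivative vanished identically, \<open>zeta\<close> would be constant on the
  convex half-plane Re s > 1. Hence its zeros are isolated in the connected punctured plane.\<close>

lemma eventually_deriv_zeta_nonzero:
  assumes "s \<noteq> 1"
  shows "\<forall>\<^sub>F w in at s. deriv zeta w \<noteq> 0"
proof -
  have "\<exists>\<beta>. \<beta> \<noteq> 1 \<and> deriv zeta \<beta> \<noteq> 0"
  proof (rule ccontr)
    assume "\<not> ?thesis"
    hence "\<exists>c. \<forall>s\<in>{s. Re s > 1}. zeta s = c"
      by (intro has_field_derivative_zero_constant convex_halfspace_Re_gt)
         (metis has_field_derivative_at_within less_irrefl mem_Collect_eq one_complex.simps(1) zeta_has_field_derivative)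
    thus False using zeta_2_ne_zeta_3 by force
  qed
  then obtain \<beta> where "\<beta> \<noteq> 1" "deriv zeta \<beta> \<noteq> 0" by blast
  hence "\<forall>\<^sub>F w in at s. deriv zeta w \<noteq> 0 \<and> w \<in> - {1}"
    using assms by (intro non_zero_neighbour_alt holomorphic_deriv zeta_holomorphic
        connected_punctured_universe) auto
  thus ?thesis by eventually_elim auto
qed

subsection \<open>The Riemann--Siegel theta function\<close>

lemma real_analytic_continuous:
  assumes "real_analytic f"
  shows "isCont f x"
proof -
  obtain a r where r: "r > 0" "\<And>y. \<bar>y - x\<bar> < r \<Longrightarrow> (\<lambda>n. a n * (y - x) ^ n) sums f y"
    using assms unfolding real_analytic_def by blast
  have s: "(\<lambda>n. a n * h ^ n) sums f (x + h)" if "norm h < r" for h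
    using r(2)[of "x + h"] that by simp
  have "(\<lambda>h. f (x + h)) \<midarrow>0\<rightarrow> a 0"
    by (rule powser_limit_0[OF r(1) s])
  moreover have "a 0 = f x"
    using sums_unique2[OF s[of 0] powser_sums_zero[of a]] r(1) by simp
  ultimately show ?thesis by (simp add: isCont_iff)
qed

text \<open>For real y and x the powers of y - x are real, so the imaginary parts of the Taylor
  coefficients give the expansion.\<close>

lemma real_analytic_Im_holomorphic:
  assumes "open S" "h holomorphic_on S" "\<real> \<subseteq> S"
  shows "real_analytic (\<lambda>t. Im (h (of_real t)))"
  unfolding real_analytic_def
proof
  fix x :: real
  have "complex_of_real x \<in> S" using assms by auto
  then obtain r where r: "r > 0" "ball (of_real x) r \<subseteq> S"
    using \<open>open S\<close> open_contains_ball by blast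
  define a where "a n = (deriv ^^ n) h (of_real x) / fact n" for n
  have "(\<lambda>n. Im (a n) * (y - x) ^ n) sums Im (h (of_real y))" if "\<bar>y - x\<bar> < r" for y
  proof -
    have "(\<lambda>n. a n * (of_real y - of_real x) ^ n) sums h (of_real y)"
      unfolding a_def
      by (rule holomorphic_power_series[OF holomorphic_on_subset[OF assms(2) r(2)]])
         (use that in \<open>simp add: dist_norm abs_minus_commute flip: of_real_diff\<close>)
    hence "(\<lambda>n. Im (a n * (of_real y - of_real x) ^ n)) sums Im (h (of_real y))"
      by (rule sums_Im)
    thus ?thesis by (simp flip: of_real_diff of_real_power)
  qed
  thus "\<exists>a r. r > 0 \<and> (\<forall>y. \<bar>y - x\<bar> < r \<longrightarrow> (\<lambda>n. a n * (y - x) ^ n) sums Im (h (of_real y)))"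
    using r(1) by (intro exI[of _ "\<lambda>n. Im (a n)"] exI[of _ r]) simp
qed

text \<open>The difference divided by 2 pi is continuous and integer-valued, hence constant. This
  yields the uniqueness of the theta function.\<close>

lemma real_functions_eq_if_exp_eq:
  fixes f g :: "real \<Rightarrow> real"
  assumes "\<And>t. isCont f t" "\<And>t. isCont g t" "f 0 = g 0"
    and "\<And>t. exp (\<i> * of_real (f t)) = exp (\<i> * of_real (g t))"
  shows "f = g"
proof -
  define d where "d t = (f t - g t) / (2 * pi)" for t
  have int: "d t \<in> \<int>" for t
  proof -
    obtain n :: int where "\<i> * of_real (f t) = \<i> * of_real (g t) + of_int (2 * n) * pi * \<i>"
      using assms(4)[of t] by (subst (asm) exp_eq) auto
    hence "Im (\<i> * of_real (f t)) = Im (\<i> * of_real (g t) + of_int (2 * n) * pi * \<i>)" by simp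
    hence "d t = of_int n" by (simp add: d_def field_simps)
    thus ?thesis by simp
  qed
  have "d constant_on UNIV"
  proof (rule continuous_discrete_range_constant)
    show "continuous_on UNIV d"
      unfolding d_def using assms(1,2) by (auto intro!: continuous_intros continuous_at_imp_continuous_on)
    show "\<exists>e>0. \<forall>y. y \<in> UNIV \<and> d y \<noteq> d x \<longrightarrow> e \<le> norm (d y - d x)" for x
      using Ints_nonzero_abs_ge1[OF Ints_diff[OF int int]] by (intro exI[of _ 1]) auto
  qed simp
  hence "d t = d 0" for t by (auto simp: constant_on_def)
  thus ?thesis using assms(3) by (auto simp: d_def)
qed

text \<open>A holomorphic function near the real axis whose imaginary part on that axis is the theta
  function.\<close>

definition theta_complex :: "complex \<Rightarrow> complex" where
  "theta_complex w = ln_Gamma (1/4 + \<i> * w / 2) - \<i> * w / 2 * of_real (ln pi)"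

lemma riemann_siegel_theta_eq:
  "riemann_siegel_theta t = Im (theta_complex (of_real t))"
proof -
  define \<theta> where "\<theta> t = Im (theta_complex (of_real t))" for t
  \<comment> \<open>Here Re(1/4 + iw/2) = 1/4 - Im w / 2 is positive, so \<open>ln_Gamma\<close> is
    holomorphic at this argument.\<close>
  define S where "S = {w. Im w < 1/2}"
  have op: "open S" unfolding S_def by (rule open_halfspace_Im_lt)
  have "(ln_Gamma \<circ> (\<lambda>w. 1/4 + \<i> * w / 2)) holomorphic_on S"
    by (rule holomorphic_on_compose_gen[OF _ holomorphic_ln_Gamma[of "{z. Re z > 0}"]])
       (auto intro!: holomorphic_intros simp: S_def complex_nonpos_Reals_iff)
  hence hol: "theta_complex holomorphic_on S"
    unfolding theta_complex_def[abs_def] o_def by (intro holomorphic_intros) auto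
  have an: "real_analytic \<theta>"
    unfolding \<theta>_def by (rule real_analytic_Im_holomorphic[OF op hol]) (auto simp: S_def elim!: Reals_cases)
  have "theta_complex 0 = of_real (ln_Gamma (1/4))"
    using ln_Gamma_complex_of_real[of "1/4"] by (simp add: theta_complex_def)
  hence 0: "\<theta> 0 = 0" by (simp add: \<theta>_def)
  have nz: "1/4 + \<i> * of_real t / 2 \<notin> \<int>\<^sub>\<le>\<^sub>0" for t
    by (auto elim!: nonpos_Ints_cases simp: complex_eq_iff)
  have eq: "Gamma (1/4 + \<i> * of_real t / 2) = of_real (norm (Gamma (1/4 + \<i> * of_real t / 2))) *
          exp (\<i> * of_real (\<theta> t + t / 2 * ln pi))" for t
  proof -
    define L where "L = ln_Gamma (1/4 + \<i> * of_real t / 2)"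
    have G: "Gamma (1/4 + \<i> * of_real t / 2) = exp L"
      using nz[of t] by (simp add: L_def Gamma_complex_altdef)
    have "\<theta> t + t / 2 * ln pi = Im L" by (simp add: \<theta>_def theta_complex_def L_def)
    moreover have "exp L = of_real (exp (Re L)) * exp (\<i> * of_real (Im L))"
      by (subst complex_eq[of L]) (simp only: exp_add exp_of_real)
    ultimately show ?thesis unfolding G norm_exp_eq_Re by simp
  qed
  have "riemann_siegel_theta = \<theta>"
    unfolding riemann_siegel_theta_def
  proof (rule the_equality)
    fix \<phi> assume \<phi>: "real_analytic \<phi> \<and> \<phi> 0 = 0 \<and>
     (\<forall>t. Gamma (1/4 + \<i> * of_real t / 2) =
          of_real (norm (Gamma (1/4 + \<i> * of_real t / 2))) *
          exp (\<i> * of_real (\<phi> t + t / 2 * ln pi)))"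
    show "\<phi> = \<theta>"
    proof (rule real_functions_eq_if_exp_eq)
      fix t
      \<comment> \<open>Gamma has no zeros, so its modulus can be cancelled.\<close>
      have "Gamma (1/4 + \<i> * of_real t / 2) \<noteq> 0"
        using nz[of t] by (simp add: Gamma_eq_zero_iff)
      hence "exp (\<i> * of_real (\<phi> t + t / 2 * ln pi)) = exp (\<i> * of_real (\<theta> t + t / 2 * ln pi))"
        using \<phi> eq[of t] by (metis mult_left_cancel norm_eq_zero of_real_eq_0_iff)
      thus "exp (\<i> * of_real (\<phi> t)) = exp (\<i> * of_real (\<theta> t))"
        by (simp add: distrib_left exp_add)
    qed (use \<phi> an 0 in \<open>auto intro: real_analytic_continuous\<close>)
  qed (use an 0 eq in blast)
  hence "riemann_siegel_theta t = \<theta> t" by (rule fun_cong)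
  thus ?thesis unfolding \<theta>_def .
qed

lemma has_real_derivative_Im:
  assumes "(h has_field_derivative D) (at (of_real t))"
  shows "((\<lambda>t. Im (h (of_real t))) has_real_derivative Im D) (at t)"
proof -
  from has_vector_derivative_real_field[OF assms]
  have "((\<lambda>t. Im (h (of_real t))) has_vector_derivative Im D) (at t)"
    by (rule bounded_linear.has_vector_derivative[OF bounded_linear_Im])
  thus ?thesis by (simp add: has_real_derivative_iff_has_vector_derivative)
qed

section \<open>The first two derivatives of theta\<close>

definition theta_deriv :: "real \<Rightarrow> real" where
  "theta_deriv t = Im (\<i> / 2 * Digamma (1/4 + \<i> * of_real t / 2) - \<i> / 2 * of_real (ln pi))"

lemma has_real_derivative_theta:
  "(riemann_siegel_theta has_real_derivative theta_deriv t) (at t)"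
proof -
  have "1/4 + \<i> * of_real t / 2 \<notin> \<real>\<^sub>\<le>\<^sub>0" by (auto simp: complex_nonpos_Reals_iff)
  hence "(theta_complex has_field_derivative
      \<i> / 2 * Digamma (1/4 + \<i> * of_real t / 2) - \<i> / 2 * of_real (ln pi)) (at (of_real t))"
    unfolding theta_complex_def[abs_def] by (auto intro!: derivative_eq_intros)
  from has_real_derivative_Im[OF this] show ?thesis
    by (simp add: riemann_siegel_theta_eq[abs_def] theta_deriv_def)
qed

lemma deriv_theta: "deriv riemann_siegel_theta t = theta_deriv t"
  by (rule DERIV_imp_deriv[OF has_real_derivative_theta])

lemma has_real_derivative_theta_deriv:
  "(theta_deriv has_real_derivative - Im (Polygamma 1 (1/4 + \<i> * of_real t / 2)) / 4) (at t)"
proof -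
  let ?h = "\<lambda>w. \<i> / 2 * Digamma (1/4 + \<i> * w / 2) - \<i> / 2 * of_real (ln pi)"
  have "1/4 + \<i> * of_real t / 2 \<notin> \<int>\<^sub>\<le>\<^sub>0"
    by (auto elim!: nonpos_Ints_cases simp: complex_eq_iff)
  hence "(?h has_field_derivative - Polygamma 1 (1/4 + \<i> * of_real t / 2) / 4) (at (of_real t))"
    by (auto intro!: derivative_eq_intros simp: mult.assoc)
  from has_real_derivative_Im[OF this] show ?thesis
    by (simp add: theta_deriv_def[abs_def])
qed

text \<open>\<open>Digamma\<close> increases on the positive reals, and \<open>Digamma 1\<close> is
  minus Euler's constant.\<close>

lemma theta_deriv_0: "theta_deriv 0 < 0"
proof -
  have "Digamma (1/4 :: complex) = of_real (Digamma (1/4))"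
    using Polygamma_of_real[of "1/4" 0] by simp
  hence eq: "theta_deriv 0 = (Digamma (1/4) - ln pi) / 2"
    by (simp add: theta_deriv_def)
  have "Digamma (1/4 :: real) < Digamma 1"
    by (rule Digamma_real_strict_mono) auto
  also have "\<dots> < 0"
    using euler_mascheroni_pos by simp
  also have "0 < ln pi"
    using pi_gt3 by simp
  finally show ?thesis by (simp add: eq)
qed

lemma Im_inverse_square: "Im (inverse (z ^ 2)) = - 2 * Re z * Im z / norm z ^ 4"
proof -
  have "norm z ^ 4 = ((Re z)\<^sup>2 + (Im z)\<^sup>2)\<^sup>2"
    using cmod_power2[of z] by (metis power_mult mult_2_right numeral_Bit0)
  also have "\<dots> = (Re (z\<^sup>2))\<^sup>2 + (Im (z\<^sup>2))\<^sup>2"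
    by (simp add: power2_eq_square algebra_simps)
  finally show ?thesis
    by (simp only: inverse_complex.simps) (simp add: power2_eq_square)
qed

text \<open>In the series of 1/(z + k)^2 every imaginary part has the sign opposite to
  \<open>Im z\<close>, so nothing cancels.\<close>

lemma Im_Polygamma_1_nonzero:
  assumes "Re z > 0" "Im z \<noteq> 0"
  shows "Im (Polygamma 1 z) \<noteq> 0"
proof -
  have "z \<noteq> 0" using assms by auto
  hence s: "summable (\<lambda>k. inverse ((z + of_nat k) ^ 2))"
    by (rule Polygamma_converges'[of z 2]) simp
  have P: "Im (Polygamma 1 z) = (\<Sum>k. Im (inverse ((z + of_nat k) ^ 2)))"
    using Im_suminf[OF s] by (simp add: Polygamma_def numeral_2_eq_2)
  \<comment> \<open>The factor \<open>- Im z\<close> treats both signs of \<open>Im z\<close> at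
    once.\<close>
  have "0 < (\<Sum>k. - Im z * Im (inverse ((z + of_nat k) ^ 2)))"
  proof (rule suminf_pos)
    show "summable (\<lambda>k. - Im z * Im (inverse ((z + of_nat k) ^ 2)))"
      by (intro summable_mult summable_Im s)
    fix k
    have "z + of_nat k \<noteq> 0" using assms by (auto simp: complex_eq_iff)
    hence "0 < 2 * (Re z + real k) * (Im z)\<^sup>2 / norm (z + of_nat k) ^ 4"
      using assms by (intro divide_pos_pos mult_pos_pos) auto
    also have "\<dots> = - Im z * Im (inverse ((z + of_nat k) ^ 2))"
      unfolding Im_inverse_square
      by (simp add: power2_eq_square algebra_simps add_divide_distrib diff_divide_distrib)
    finally show "0 < - Im z * Im (inverse ((z + of_nat k) ^ 2))" .
  qed
  also have "\<dots> = - Im z * Im (Polygamma 1 z)"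
    unfolding P by (intro suminf_mult summable_Im s)
  finally show ?thesis by auto
qed

subsection \<open>The critical line\<close>

lemma critical_line_ne_1: "1/2 + \<i> * of_real t \<noteq> (1::complex)"
  by (simp add: complex_eq_iff)

lemma hardy_Z_has_vector_derivative:
  defines "s \<equiv> \<lambda>t. 1/2 + \<i> * complex_of_real t"
  shows "(hardy_Z has_vector_derivative \<i> * exp (\<i> * of_real (riemann_siegel_theta t)) *
      (deriv zeta (s t) + of_real (theta_deriv t) * zeta (s t))) (at t)"
proof -
  have "((\<lambda>w. zeta (1/2 + \<i> * w)) has_field_derivative deriv zeta (s t) * \<i>) (at (of_real t))"
    by (rule DERIV_chain'[where g = zeta and f = "\<lambda>w. 1/2 + \<i> * w", THEN DERIV_cong])
       (auto intro!: derivative_eq_intros zeta_has_field_derivative critical_line_ne_1 simp: s_def)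
  from has_vector_derivative_real_field[OF this]
  have z: "((\<lambda>t. zeta (s t)) has_vector_derivative deriv zeta (s t) * \<i>) (at t)"
    by (simp add: s_def)
  have "((\<lambda>t. of_real (riemann_siegel_theta t) :: complex) has_vector_derivative of_real (theta_deriv t)) (at t)"
    by (rule has_vector_derivative_of_real) (rule has_real_derivative_theta)
  hence "((\<lambda>t. \<i> * of_real (riemann_siegel_theta t)) has_vector_derivative \<i> * of_real (theta_deriv t)) (at t)"
    by (rule has_vector_derivative_mult_right)
  from field_vector_diff_chain_at[OF this DERIV_exp]
  have e: "((\<lambda>t. exp (\<i> * of_real (riemann_siegel_theta t))) has_vector_derivative
      \<i> * of_real (theta_deriv t) * exp (\<i> * of_real (riemann_siegel_theta t))) (at t)"
    by (simp add: o_def)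
  from has_vector_derivative_mult[OF e z] show ?thesis
    unfolding hardy_Z_def[abs_def] s_def by (simp add: algebra_simps)
qed

text \<open>A zero t of \<open>theta_deriv\<close> is not 0, since \<open>theta_deriv 0\<close> is
  negative; elsewhere the second derivative is -1/4 times a nonzero imaginary part of the trigamma
  function.\<close>

lemma theta_deriv_zero_imp_simple:
  assumes "theta_deriv t = 0"
  obtains D where "(theta_deriv has_real_derivative D) (at t)" "D \<noteq> 0"
proof
  have "t \<noteq> 0" using assms theta_deriv_0 by auto
  hence "Im (Polygamma 1 (1/4 + \<i> * of_real t / 2)) \<noteq> 0"
    by (intro Im_Polygamma_1_nonzero) auto
  thus "- Im (Polygamma 1 (1/4 + \<i> * of_real t / 2)) / 4 \<noteq> 0" by simp
qed (rule has_real_derivative_theta_deriv)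

lemma zeta_zero_if_deriv_zero:
  assumes \<kappa>: "is_kappa \<kappa>"
    and zeta': "deriv zeta (1/2 + \<i> * of_real t) = 0"
    and theta': "theta_deriv t = 0"
  shows "zeta (1/2 + \<i> * of_real t) = 0"
proof -
  define s where "s u = 1/2 + \<i> * complex_of_real u" for u
  have s: "s u \<noteq> 1" for u
    unfolding s_def by (rule critical_line_ne_1)
  obtain D where D: "(theta_deriv has_real_derivative D) (at t)" "D \<noteq> 0"
    using theta_deriv_zero_imp_simple[OF theta'] .
  have \<kappa>_eq: "exp (2 * of_real pi * \<i> * of_real (\<kappa> u)) =
      1 + 2 * (of_real (theta_deriv u) * zeta_quotient u)" for u
    using \<kappa> by (simp add: is_kappa_def deriv_theta mult.assoc)
  have "isCont \<kappa> t"
    using \<kappa> by (auto simp: is_kappa_def intro: real_analytic_continuous)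
  hence "isCont (\<lambda>u. (exp (2 * of_real pi * \<i> * of_real (\<kappa> u)) - 1) / 2) t"
    by (intro continuous_intros) auto
  \<comment> \<open>The limit is the value at t, where \<open>zeta_quotient\<close> takes its
    default value 0.\<close>
  hence lim1: "((\<lambda>u. of_real (theta_deriv u) * zeta_quotient u) \<longlongrightarrow> 0) (at t)"
    unfolding \<kappa>_eq using zeta' by (simp add: isCont_def zeta_quotient_def)

  have at_s: "filterlim s (at (s t)) (at t)"
  proof -
    have "isCont s t" unfolding s_def by (intro continuous_intros)
    thus ?thesis
      by (simp add: filterlim_at isCont_def eventually_at_filter s_def)
  qed
  have "(deriv zeta has_field_derivative deriv (deriv zeta) (s t)) (at (s t))"
    using s by (intro holomorphic_derivI[OF holomorphic_deriv[OF zeta_holomorphic]]) auto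
  hence "((\<lambda>w. deriv zeta w / (w - s t)) \<longlongrightarrow> deriv (deriv zeta) (s t)) (at (s t))"
    using zeta' by (simp add: has_field_derivative_iff s_def)
  from filterlim_compose[OF this at_s]
  have lim2: "((\<lambda>u. deriv zeta (s u) / (s u - s t)) \<longlongrightarrow> deriv (deriv zeta) (s t)) (at t)" .

  have "((\<lambda>u. theta_deriv u / (u - t)) \<longlongrightarrow> D) (at t)"
    using D(1) theta' by (simp add: has_field_derivative_iff)
  moreover have "(zeta \<longlongrightarrow> zeta (s t)) (at (s t))"
    using DERIV_isCont[OF zeta_has_field_derivative[OF s]] by (simp add: isCont_def)
  ultimately have lim3: "((\<lambda>u. of_real (theta_deriv u / (u - t)) * zeta (s u)) \<longlongrightarrow> of_real D * zeta (s t)) (at t)"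
    by (intro tendsto_intros filterlim_compose[OF _ at_s])

  \<comment> \<open>Near t, but off t, \<open>zeta_quotient\<close> is a genuine quotient, so its
    denominator cancels. The factor \<open>\<i>\<close> offsets that in s(u) - s(t) = i(u -
    t).\<close>
  have "\<forall>\<^sub>F u in at t. deriv zeta (s u) \<noteq> 0"
    using at_s eventually_deriv_zeta_nonzero[OF s] by (rule eventually_compose_filterlim[rotated])
  hence "\<forall>\<^sub>F u in at t. of_real (theta_deriv u) * zeta_quotient u * (\<i> * (deriv zeta (s u) / (s u - s t))) =
      of_real (theta_deriv u / (u - t)) * zeta (s u)"
    using eventually_neq_at_within[of t t]
  proof eventually_elim
    case (elim u)
    have "s u - s t = \<i> * of_real (u - t)"
      by (simp add: s_def algebra_simps)
    thus ?case using elim unfolding zeta_quotient_def s_def[symmetric]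
      by (simp del: of_real_diff)
  qed
  moreover have "((\<lambda>u. of_real (theta_deriv u) * zeta_quotient u * (\<i> * (deriv zeta (s u) / (s u - s t)))) \<longlongrightarrow>
      0 * (\<i> * deriv (deriv zeta) (s t))) (at t)"
    by (intro tendsto_mult tendsto_const lim1 lim2)
  ultimately have "((\<lambda>u. of_real (theta_deriv u / (u - t)) * zeta (s u)) \<longlongrightarrow> 0) (at t)"
    by (simp add: filterlim_cong)
  \<comment> \<open>Two limits of one function: \<open>D\<close> times the value of
    \<open>zeta\<close> is 0, and \<open>D\<close> is nonzero.\<close>
  from tendsto_unique[OF _ lim3 this] show ?thesis
    using D(2) by (simp add: s_def)
qed

text \<open>Writes -1 as exp(pi i) and uses the period 2 pi i.\<close>

lemma half_odd_iff_exp: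
  "(\<exists>k::int. x = (2 * of_int k + 1) / 2) \<longleftrightarrow> exp (2 * of_real pi * \<i> * of_real x) = - 1"
proof -
  have "exp (2 * of_real pi * \<i> * of_real x) = - 1 \<longleftrightarrow>
      exp (2 * of_real pi * \<i> * of_real x) = exp (of_real pi * \<i>)" by simp
  also have "\<dots> \<longleftrightarrow> (\<exists>k::int. 2 * of_real pi * \<i> * of_real x = of_real pi * \<i> + of_int (2 * k) * pi * \<i>)"
    by (rule exp_eq)
  also have "\<dots> \<longleftrightarrow> (\<exists>k::int. x = (2 * of_int k + 1) / 2)"
  proof (intro ex_cong1)
    fix k :: int
    have "2 * of_real pi * \<i> * of_real x = of_real pi * \<i> + of_int (2 * k) * pi * \<i> \<longleftrightarrow>
        2 * pi * x = pi + 2 * of_int k * pi"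
      by (simp add: complex_eq_iff)
    also have "\<dots> \<longleftrightarrow> pi * (2 * x) = pi * (2 * of_int k + 1)"
      by (simp add: algebra_simps)
    also have "\<dots> \<longleftrightarrow> x = (2 * of_int k + 1) / 2"
      by (simp only: mult_cancel_left) auto
    finally show "2 * of_real pi * \<i> * of_real x = of_real pi * \<i> + of_int (2 * k) * pi * \<i> \<longleftrightarrow>
        x = (2 * of_int k + 1) / 2" .
  qed
  finally show ?thesis by blast
qed

theorem proposition23:
  fixes \<kappa> :: "real \<Rightarrow> real" and t :: real
  assumes "is_kappa \<kappa>"
  shows "(\<exists>k::int. \<kappa> t = (2 * of_int k + 1) / 2) \<longleftrightarrow>
         vector_derivative hardy_Z (at t) = 0 \<and> hardy_Z t \<noteq> 0"
proof -
  define z where "z = zeta (1/2 + \<i> * of_real t)"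
  define z' where "z' = deriv zeta (1/2 + \<i> * of_real t)"
  define \<theta>' where "\<theta>' = complex_of_real (theta_deriv t)"
  have "(\<exists>k::int. \<kappa> t = (2 * of_int k + 1) / 2) \<longleftrightarrow> 1 + 2 * \<theta>' * zeta_quotient t = - 1"
    unfolding half_odd_iff_exp using assms by (simp add: is_kappa_def deriv_theta \<theta>'_def)
  also have "\<dots> \<longleftrightarrow> 2 * (\<theta>' * zeta_quotient t) = 2 * - 1"
    by (auto simp: algebra_simps eq_neg_iff_add_eq_0)
  also have "\<dots> \<longleftrightarrow> \<theta>' * zeta_quotient t = - 1"
    by (subst mult_cancel_left) auto
  also have "\<dots> \<longleftrightarrow> z' + \<theta>' * z = 0 \<and> z \<noteq> 0"
  proof (cases "z' = 0")
    \<comment> \<open>The left side is 0 = -1. The right side would give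
      \<open>\<theta>' * z = 0\<close> with z nonzero, hence \<open>\<theta>' = 0\<close>, which
      forces z = 0.\<close>
    case True
    have "z = 0" if "\<theta>' = 0"
      using zeta_zero_if_deriv_zero[OF assms] that True by (simp add: z_def z'_def \<theta>'_def)
    thus ?thesis using True by (auto simp: zeta_quotient_def z'_def)
  next
    case False
    hence "zeta_quotient t = z / z'"
      by (simp add: zeta_quotient_def z_def z'_def)
    hence "\<theta>' * zeta_quotient t = - 1 \<longleftrightarrow> \<theta>' * z = - z'"
      using False by (simp add: divide_eq_eq)
    also have "\<dots> \<longleftrightarrow> z' + \<theta>' * z = 0"
      by (simp add: eq_neg_iff_add_eq_0 add.commute)
    finally show ?thesis using False by auto
  qed
  also have "z' + \<theta>' * z = 0 \<longleftrightarrow> vector_derivative hardy_Z (at t) = 0"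
    using vector_derivative_at[OF hardy_Z_has_vector_derivative[of t]]
    by (simp add: z_def z'_def \<theta>'_def)
  also have "z \<noteq> 0 \<longleftrightarrow> hardy_Z t \<noteq> 0"
    by (simp add: hardy_Z_def z_def)
  finally show ?thesis .
qed

end
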